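(* Let $\mathbf{H}\in\mathbb{R}^{V\times V}$ be a graph filter. Then $\mathbf{H}$ is a polynomial filter of $\mathbf{S}_1,\ldots,\mathbf{S}_d$ if and only if there exist real numbers $\mu_m$, $1\le m\le M$, such that $$\mathbf{P}_m\mathbf{H}=\mathbf{H}\mathbf{P}_m=\mu_m\mathbf{P}_m,\quad 1\le m\le M.$$
   Context: Let $\mathcal{G}=(V,E,\mathbf{W})$ be a finite, simple, undirected graph with $N\ge 2$ vertices. A graph filter is a real matrix in $\mathbb{R}^{V\times V}$. A graph shift is a matrix $\mathbf{S}=[s(i,j)]_{i,j\in V}$ with $s(i,j)=0$ unless $i=j$ or $(i,j)\in E$. Standing assumption: $\mathbf{S}_1,\ldots,\mathbf{S}_d$ are graph shifts that are real-valued, symmetric and pairwise commuting. Choose an orthogonal matrix $\mathbf{U}=[\mathbf{u}_1,\ldots,\mathbf{u}_N]$ with $\mathbf{S}_l=\sum_{n=1}^N\lambda_l(n)\mathbf{u}_n\mathbf{u}_n^T$ for $1\le l\le d$, and set $\boldsymbol{\lambda}(n)=[\lambda_1(n),\ldots,\lambda_d(n)]^T\in\mathbb{R}^d$. Let $\boldsymbol{\gamma}(m)=[\gamma_1(m),\ldots,\gamma_d(m)]^T$, $1\le m\le M$, be the distinct elements of $\{\boldsymbol{\lambda}(n): 1\le n\le N\}$. Put $\mathbf{P}_m=\sum_{\boldsymbol{\lambda}(n)=\boldsymbol{\gamma}(m)}\mathbf{u}_n\mathbf{u}_n^T$ (the orthogonal projection onto $\bigcap_{l=1}^d\ker(\mathbf{S}_l-\gamma_l(m)\mathbf{I})$,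 independent of the choice of $\mathbf{U}$). A polynomial filter is a matrix of the form $h(\mathbf{S}_1,\ldots,\mathbf{S}_d)$ for some real multivariate polynomial $h(t_1,\ldots,t_d)$. *)

theory Defs
  imports "HOL-Analysis.Analysis" "HOL-Library.Poly_Mapping"
begin

text \<open>
  The vertex set is a finite type \<open>'v\<close> and the edge set a symmetric irreflexive relation on it.
  The weight matrix is only required to be symmetric and supported on the edges; in particular
  no sign condition is imposed on the weights.
\<close>

definition weighted_graph :: "('v::finite \<times> 'v) set \<Rightarrow> real^'v^'v \<Rightarrow> bool" where
  "weighted_graph E W \<longleftrightarrow>
     sym E \<and> irrefl E \<and> transpose W = W \<and> (\<forall>i j. (i, j) \<notin> E \<longrightarrow> W $ i $ j = 0)"

definition graph_shift :: "('v::finite \<times> 'v) set \<Rightarrow> real^'v^'v \<Rightarrow> bool" where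
  "graph_shift E S \<longleftrightarrow> (\<forall>i j. i \<noteq> j \<and> (i, j) \<notin> E \<longrightarrow> S $ i $ j = 0)"

definition outer_square :: "real^'v \<Rightarrow> real^'v^'v::finite" where
  "outer_square u = (\<chi> i j. u $ i * u $ j)"

text \<open>
  The columns of \<open>U\<close>, and the joint eigenvalues, are labelled by \<open>'v\<close> itself instead of
  \<open>1, \<dots>, N\<close> with \<open>N = CARD('v)\<close>: a square matrix has the same row and column index type.
\<close>

definition joint_diagonalization ::
    "('d \<Rightarrow> real^'v^'v::finite) \<Rightarrow> real^'v^'v \<Rightarrow> ('d \<Rightarrow> 'v \<Rightarrow> real) \<Rightarrow> bool" where
  "joint_diagonalization S U lam \<longleftrightarrow>
     orthogonal_matrix U \<and>
     (\<forall>l. S l = (\<Sum>n\<in>UNIV. lam l n *\<^sub>R outer_square (column n U)))"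

definition joint_eigenvalue :: "('d::finite \<Rightarrow> 'v \<Rightarrow> real) \<Rightarrow> 'v \<Rightarrow> real^'d" where
  "joint_eigenvalue lam n = (\<chi> l. lam l n)"

definition joint_eigenprojection ::
    "real^'v^'v::finite \<Rightarrow> ('d::finite \<Rightarrow> 'v \<Rightarrow> real) \<Rightarrow> real^'d \<Rightarrow> real^'v^'v" where
  "joint_eigenprojection U lam g =
     (\<Sum>n | joint_eigenvalue lam n = g. outer_square (column n U))"

text \<open>
  \<open>(^)\<close> and \<open>(*)\<close> on the type \<open>real^'v^'v\<close> are componentwise, hence the explicit matrix power.
\<close>

definition matrix_power :: "real^'v^'v::finite \<Rightarrow> nat \<Rightarrow> real^'v^'v" where
  "matrix_power A k = (((**) A) ^^ k) (mat 1)"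

text \<open>
  Real polynomials in variables \<open>t\<^sub>l\<close>, \<open>l\<close> ranging over the finite type \<open>'d\<close>, are finitely
  supported coefficient functions on exponent vectors.  The matrix product in a monomial is a
  fold over all of \<open>'d\<close> in unspecified order, meaningful because it is only used for pairwise
  commuting \<open>S\<close>.
\<close>

type_synonym 'd real_mpoly = "('d \<Rightarrow>\<^sub>0 nat) \<Rightarrow>\<^sub>0 real"

definition matrix_monomial ::
    "('d::finite \<Rightarrow> real^'v^'v::finite) \<Rightarrow> ('d \<Rightarrow>\<^sub>0 nat) \<Rightarrow> real^'v^'v" where
  "matrix_monomial S a =
     Finite_Set.fold (\<lambda>l A. matrix_power (S l) (Poly_Mapping.lookup a l) ** A) (mat 1) UNIV"

definition matrix_eval_mpoly ::
    "('d::finite \<Rightarrow> real^'v^'v::finite) \<Rightarrow> 'd real_mpoly \<Rightarrow> real^'v^'v" where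
  "matrix_eval_mpoly S h = (\<Sum>a\<in>Poly_Mapping.keys h. Poly_Mapping.lookup h a *\<^sub>R matrix_monomial S a)"

definition polynomial_filter ::
    "('d::finite \<Rightarrow> real^'v^'v::finite) \<Rightarrow> real^'v^'v \<Rightarrow> bool" where
  "polynomial_filter S H \<longleftrightarrow> (\<exists>h. H = matrix_eval_mpoly S h)"

end

theory Submission
  imports Defs
begin

text \<open>
  In the common eigenbasis every matrix built from the shifts is diagonal, and
  \<open>h(S\<^sub>1, \<dots>, S\<^sub>d)\<close> has the diagonal entries \<open>h(\<lambda>(n))\<close>; this gives one direction with
  \<open>\<mu>\<^sub>m = h(\<gamma>(m))\<close>. Conversely the projections sum to the identity, so \<open>H\<close> is the diagonal
  matrix \<open>\<Sum>\<^sub>m \<mu>\<^sub>m P\<^sub>m\<close>, and a polynomial interpolating \<open>\<gamma>(m) \<mapsto> \<mu>\<^sub>m\<close> evaluates to it.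
\<close>

subsection \<open>Multivariate interpolation\<close>

definition monomial_value :: "('d::finite \<Rightarrow>\<^sub>0 nat) \<Rightarrow> real^'d \<Rightarrow> real" where
  "monomial_value a x = (\<Prod>l\<in>UNIV. (x $ l) ^ Poly_Mapping.lookup a l)"

text \<open>The scalar counterpart of \<open>matrix_eval_mpoly\<close>, with the same sum over
  \<open>keys\<close>, so that the two evaluations can be compared term by term.\<close>

definition mpoly_value :: "'d::finite real_mpoly \<Rightarrow> real^'d \<Rightarrow> real" where
  "mpoly_value h x = (\<Sum>a\<in>Poly_Mapping.keys h. Poly_Mapping.lookup h a * monomial_value a x)"

lemma monomial_value_0 [simp]: "monomial_value 0 x = 1"
  by (simp add: monomial_value_def)

lemma monomial_value_add: "monomial_value (a + b) x = monomial_value a x * monomial_value b x"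
  by (simp add: monomial_value_def lookup_add power_add prod.distrib)

lemma monomial_value_single: "monomial_value (Poly_Mapping.single l 1) x = x $ l"
proof -
  have "monomial_value (Poly_Mapping.single l 1) x = (\<Prod>k\<in>UNIV. if k = l then x $ l else 1)"
    unfolding monomial_value_def by (rule prod.cong) (auto simp: lookup_single)
  then show ?thesis by simp
qed

text \<open>Coefficients outside \<open>keys\<close> vanish. Polynomials with different supports, or
  with cancellation in their sum, can thus be evaluated over one common index set.\<close>

lemma mpoly_value_superset:
  assumes "finite A" "Poly_Mapping.keys h \<subseteq> A"
  shows "mpoly_value h x = (\<Sum>a\<in>A. Poly_Mapping.lookup h a * monomial_value a x)"
  unfolding mpoly_value_def using assms
  by (intro sum.mono_neutral_left) (auto simp: in_keys_iff)

lemma mpoly_value_0 [simp]: "mpoly_value 0 x = 0"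
  by (simp add: mpoly_value_def)

lemma mpoly_value_add: "mpoly_value (h + g) x = mpoly_value h x + mpoly_value g x"
proof -
  let ?A = "Poly_Mapping.keys h \<union> Poly_Mapping.keys g"
  have "Poly_Mapping.keys (h + g) \<subseteq> ?A" by (rule Poly_Mapping.keys_add)
  then show ?thesis
    by (simp add: mpoly_value_superset[of ?A] lookup_add algebra_simps sum.distrib)
qed

lemma mpoly_value_sum: "mpoly_value (\<Sum>i\<in>I. h i) x = (\<Sum>i\<in>I. mpoly_value (h i) x)"
  by (induction I rule: infinite_finite_induct) (auto simp: mpoly_value_add)

lemma mpoly_value_single: "mpoly_value (Poly_Mapping.single a c) x = c * monomial_value a x"
  by (simp add: mpoly_value_def)

lemma mpoly_eq_sum_singles:
  "h = (\<Sum>a\<in>Poly_Mapping.keys h. Poly_Mapping.single a (Poly_Mapping.lookup h a))"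
  by (rule poly_mapping_eqI) (simp add: lookup_sum lookup_single when_def in_keys_iff)

text \<open>The product of coefficient functions is a convolution. Splitting both factors into
  single terms reduces it to adding exponents, which \<open>monomial_value\<close> turns into
  multiplication.\<close>

lemma mpoly_value_mult: "mpoly_value (h * g) x = mpoly_value h x * mpoly_value g x"
proof -
  have "h * g = (\<Sum>a\<in>Poly_Mapping.keys h. Poly_Mapping.single a (Poly_Mapping.lookup h a))
      * (\<Sum>b\<in>Poly_Mapping.keys g. Poly_Mapping.single b (Poly_Mapping.lookup g b))"
    by (simp flip: mpoly_eq_sum_singles)
  also have "\<dots> = (\<Sum>a\<in>Poly_Mapping.keys h. \<Sum>b\<in>Poly_Mapping.keys g.
      Poly_Mapping.single (a + b) (Poly_Mapping.lookup h a * Poly_Mapping.lookup g b))"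
    by (simp add: sum_product mult_single)
  finally have "h * g = (\<Sum>a\<in>Poly_Mapping.keys h. \<Sum>b\<in>Poly_Mapping.keys g.
      Poly_Mapping.single (a + b) (Poly_Mapping.lookup h a * Poly_Mapping.lookup g b))" .
  then have "mpoly_value (h * g) x = (\<Sum>a\<in>Poly_Mapping.keys h. \<Sum>b\<in>Poly_Mapping.keys g.
      (Poly_Mapping.lookup h a * monomial_value a x) * (Poly_Mapping.lookup g b * monomial_value b x))"
    by (simp add: mpoly_value_sum mpoly_value_single monomial_value_add mult_ac)
  then show ?thesis by (simp add: mpoly_value_def sum_product)
qed

text \<open>A Lagrange-type product with one affine factor for each point of
  \<open>Z\<close>.\<close>

lemma mpoly_separating_point:
  assumes "finite Z" "z \<notin> Z"
  shows "\<exists>h. mpoly_value h z = 1 \<and> (\<forall>x\<in>Z. mpoly_value h x = 0)"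
  using assms
proof (induction Z)
  case empty
  show ?case by (rule exI[of _ "Poly_Mapping.single 0 1"]) (simp add: mpoly_value_single del: single_one)
next
  case (insert y Z)
  then obtain h where h: "mpoly_value h z = 1" "\<forall>x\<in>Z. mpoly_value h x = 0" by auto
  from insert.prems obtain l where l: "z $ l \<noteq> y $ l" by (auto simp: vec_eq_iff)
  \<comment> \<open>The affine factor (t_l - y_l) / (z_l - y_l), in a coordinate \<open>l\<close>
    where \<open>z\<close> and \<open>y\<close> differ: it is 1 at \<open>z\<close> and 0 at
    \<open>y\<close>.\<close>
  define k :: "(_ \<Rightarrow>\<^sub>0 nat) \<Rightarrow>\<^sub>0 real" where
    "k = Poly_Mapping.single (Poly_Mapping.single l 1) (1 / (z $ l - y $ l))
    + Poly_Mapping.single 0 (- (y $ l) / (z $ l - y $ l))"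
  have k: "mpoly_value k x = (x $ l - y $ l) / (z $ l - y $ l)" for x
    by (simp add: k_def mpoly_value_add mpoly_value_single
      monomial_value_single[unfolded One_nat_def] diff_divide_distrib)
  show ?case
    by (rule exI[of _ "h * k"]) (use h l in \<open>auto simp: mpoly_value_mult k\<close>)
qed

lemma mpoly_interpolation:
  assumes "finite Z"
  shows "\<exists>h. \<forall>x\<in>Z. mpoly_value h x = f x"
  using assms
proof (induction Z)
  case (insert z Z)
  then obtain h where h: "\<forall>x\<in>Z. mpoly_value h x = f x" by auto
  from insert.hyps obtain k where k: "mpoly_value k z = 1" "\<forall>x\<in>Z. mpoly_value k x = 0"
    using mpoly_separating_point by blast
  \<comment> \<open>Newton's correction: the error of \<open>h\<close> at \<open>z\<close> is added
    as a multiple of \<open>k\<close>, which leaves the values on \<open>Z\<close>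
    unchanged.\<close>
  show ?case
    by (rule exI[of _ "h + Poly_Mapping.single 0 (f z - mpoly_value h z) * k"])
       (use h k in \<open>auto simp: mpoly_value_add mpoly_value_mult mpoly_value_single\<close>)
qed simp

subsection \<open>Functional calculus in an orthonormal basis\<close>

text \<open>The matrix U diag(f) U^T. Since \<open>f\<close> is a function of the column label,
  shifts, eigenprojections and polynomial filters all take this form.\<close>

definition spectral_matrix :: "real^'v^'v::finite \<Rightarrow> ('v \<Rightarrow> real) \<Rightarrow> real^'v^'v" where
  "spectral_matrix U f = (\<Sum>n\<in>UNIV. f n *\<^sub>R outer_square (column n U))"

lemma spectral_matrix_nth:
  "spectral_matrix U f $ i $ j = (\<Sum>n\<in>UNIV. f n * (U $ i $ n * U $ j $ n))"
  by (simp add: spectral_matrix_def outer_square_def column_def)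

lemma spectral_matrix_1:
  assumes "orthogonal_matrix U"
  shows "spectral_matrix U (\<lambda>_. 1) = mat 1"
proof -
  have "spectral_matrix U (\<lambda>_. 1) = U ** transpose U"
    by (simp add: vec_eq_iff spectral_matrix_nth matrix_matrix_mult_def transpose_def)
  then show ?thesis using assms by (simp add: orthogonal_matrix_def)
qed

lemma spectral_matrix_diagonal:
  "spectral_matrix U f = U ** (\<chi> i j. if i = j then f i else 0) ** transpose U"
  by (simp add: vec_eq_iff spectral_matrix_nth matrix_matrix_mult_def transpose_def
      if_distrib[of "(*) _"] if_distribR cong: if_cong)
     (simp add: mult_ac)

text \<open>The inner factor U^T U cancels and diagonal matrices multiply entrywise. In particular,
  any two such matrices commute.\<close>

lemma spectral_matrix_mult:
  assumes "orthogonal_matrix U"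
  shows "spectral_matrix U f ** spectral_matrix U g = spectral_matrix U (\<lambda>n. f n * g n)"
proof -
  let ?D = "\<lambda>f. (\<chi> i j. if i = j then f i else 0) :: real^'a^'a"
  have "?D f ** ?D g = ?D (\<lambda>n. f n * g n)"
    by (simp add: vec_eq_iff matrix_matrix_mult_def if_distrib[of "(*) _"] if_distribR cong: if_cong)
  moreover have "spectral_matrix U f ** spectral_matrix U g
      = U ** (?D f ** (transpose U ** U) ** ?D g) ** transpose U"
    by (simp add: spectral_matrix_diagonal matrix_mul_assoc)
  ultimately show ?thesis
    using assms by (simp add: orthogonal_matrix_def spectral_matrix_diagonal)
qed

lemma spectral_matrix_scaleR: "c *\<^sub>R spectral_matrix U f = spectral_matrix U (\<lambda>n. c * f n)"
  by (simp add: spectral_matrix_def scaleR_sum_right)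

lemma spectral_matrix_sum:
  "(\<Sum>i\<in>I. spectral_matrix U (f i)) = spectral_matrix U (\<lambda>n. \<Sum>i\<in>I. f i n)"
  by (simp add: spectral_matrix_def scaleR_sum_left sum.swap[of _ I])

lemma matrix_power_spectral_matrix:
  assumes "orthogonal_matrix U"
  shows "matrix_power (spectral_matrix U f) k = spectral_matrix U (\<lambda>n. f n ^ k)"
  by (induction k)
     (use assms in \<open>simp_all add: matrix_power_def spectral_matrix_1 spectral_matrix_mult\<close>)

lemma matrix_monomial_spectral_matrix:
  assumes U: "orthogonal_matrix U"
  shows "matrix_monomial (\<lambda>l. spectral_matrix U (lam l)) a
    = spectral_matrix U (\<lambda>n. monomial_value a (joint_eigenvalue lam n))"
proof -
  let ?f = "\<lambda>l. (**) (spectral_matrix U (\<lambda>n. lam l n ^ Poly_Mapping.lookup a l))"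
  \<comment> \<open>The factors are diagonal in the same basis, so the left multiplications commute
    and the fold does not depend on the order of the variables.\<close>
  interpret comp_fun_commute ?f
    by standard (simp add: fun_eq_iff U matrix_mul_assoc spectral_matrix_mult mult.commute)
  have "Finite_Set.fold ?f (mat 1) L
      = spectral_matrix U (\<lambda>n. \<Prod>l\<in>L. lam l n ^ Poly_Mapping.lookup a l)" if "finite L" for L
    using that
  proof induction
    case (insert l L)
    then show ?case
      by (simp add: fold_insert spectral_matrix_mult U)
  qed (simp add: spectral_matrix_1 U)
  then show ?thesis
    by (simp add: matrix_monomial_def monomial_value_def joint_eigenvalue_def
        matrix_power_spectral_matrix U)
qed

lemma matrix_eval_mpoly_spectral_matrix:
  assumes "orthogonal_matrix U"
  shows "matrix_eval_mpoly (\<lambda>l. spectral_matrix U (lam l)) h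
    = spectral_matrix U (\<lambda>n. mpoly_value h (joint_eigenvalue lam n))"
  by (simp add: matrix_eval_mpoly_def matrix_monomial_spectral_matrix assms
      spectral_matrix_scaleR spectral_matrix_sum mpoly_value_def)

text \<open>An eigenprojection is the functional calculus applied to the indicator of a level set of
  the joint eigenvalue.\<close>

lemma joint_eigenprojection_eq_spectral_matrix:
  "joint_eigenprojection U lam g = spectral_matrix U (\<lambda>n. of_bool (joint_eigenvalue lam n = g))"
proof -
  have "(\<Sum>n\<in>UNIV. of_bool (joint_eigenvalue lam n = g) *\<^sub>R outer_square (column n U))
      = (\<Sum>n\<in>UNIV. if joint_eigenvalue lam n = g then outer_square (column n U) else 0)"
    by (rule sum.cong) auto
  then show ?thesis
    by (simp add: joint_eigenprojection_def spectral_matrix_def sum.If_cases)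
qed

theorem theorem2p7:
  fixes E :: "('v::finite \<times> 'v) set"
    and W :: "real^'v^'v"
    and S :: "'d::finite \<Rightarrow> real^'v^'v"
    and U :: "real^'v^'v"
    and lam :: "'d \<Rightarrow> 'v \<Rightarrow> real"
    and M :: nat
    and \<gamma> :: "nat \<Rightarrow> real^'d"
    and P :: "nat \<Rightarrow> real^'v^'v"
    and H :: "real^'v^'v"
  assumes "CARD('v) \<ge> 2"
    and "weighted_graph E W"
    and "\<And>l. graph_shift E (S l)"
    and "\<And>l. transpose (S l) = S l"
    and "\<And>k l. S k ** S l = S l ** S k"
    and "joint_diagonalization S U lam"
    and "bij_betw \<gamma> {1..M} (range (joint_eigenvalue lam))"
    and "\<And>m. m \<in> {1..M} \<Longrightarrow> P m = joint_eigenprojection U lam (\<gamma> m)"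
  shows "polynomial_filter S H \<longleftrightarrow>
    (\<exists>\<mu> :: nat \<Rightarrow> real. \<forall>m\<in>{1..M}.
       P m ** H = H ** P m \<and> H ** P m = \<mu> m *\<^sub>R P m)"
proof -
  have U: "orthogonal_matrix U" and S: "S = (\<lambda>l. spectral_matrix U (lam l))"
    using assms(6) by (auto simp: joint_diagonalization_def spectral_matrix_def)
  have P: "P m = spectral_matrix U (\<lambda>n. of_bool (joint_eigenvalue lam n = \<gamma> m))"
    if "m \<in> {1..M}" for m
    using assms(8)[OF that] by (simp add: joint_eigenprojection_eq_spectral_matrix)
  show ?thesis
  proof
    assume "polynomial_filter S H"
    then obtain h where h: "H = spectral_matrix U (\<lambda>n. mpoly_value h (joint_eigenvalue lam n))"
      by (auto simp: polynomial_filter_def S matrix_eval_mpoly_spectral_matrix U)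
    \<comment> \<open>Where the indicator in \<open>P m\<close> is nonzero, the joint eigenvalue is
      \<open>\<gamma> m\<close>, so the diagonal entry of \<open>H\<close> there is the constant
      h(\<gamma>(m)).\<close>
    have "P m ** H = H ** P m \<and> H ** P m = mpoly_value h (\<gamma> m) *\<^sub>R P m" if "m \<in> {1..M}" for m
      by (auto simp: h P[OF that] spectral_matrix_mult U spectral_matrix_scaleR mult.commute
          intro!: arg_cong[of _ _ "spectral_matrix U"])
    then show "\<exists>\<mu>. \<forall>m\<in>{1..M}. P m ** H = H ** P m \<and> H ** P m = \<mu> m *\<^sub>R P m"
      by (intro exI[of _ "\<lambda>m. mpoly_value h (\<gamma> m)"]) simp
  next
    assume "\<exists>\<mu>. \<forall>m\<in>{1..M}. P m ** H = H ** P m \<and> H ** P m = \<mu> m *\<^sub>R P m"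
    then obtain \<mu> where \<mu>: "\<And>m. m \<in> {1..M} \<Longrightarrow> H ** P m = \<mu> m *\<^sub>R P m" by blast
    \<comment> \<open>Exactly one indicator is 1 at each label: surjectivity of
      \<open>\<gamma>\<close> onto the joint eigenvalues gives one, injectivity excludes a
      second.\<close>
    have one: "(\<Sum>m\<in>{1..M}. of_bool (joint_eigenvalue lam n = \<gamma> m)) = (1::real)" for n
    proof -
      obtain m where m: "m \<in> {1..M}" "joint_eigenvalue lam n = \<gamma> m"
        using assms(7) unfolding bij_betw_def by blast
      have "joint_eigenvalue lam n = \<gamma> k \<longleftrightarrow> k = m" if "k \<in> {1..M}" for k
        using that m assms(7) unfolding bij_betw_def inj_on_def by metis
      then have "(\<Sum>k\<in>{1..M}. of_bool (joint_eigenvalue lam n = \<gamma> k)) = (\<Sum>k\<in>{1..M}. if k = m then 1 else (0::real))"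
        by (intro sum.cong) auto
      then show ?thesis using m by simp
    qed
    have "(\<Sum>m\<in>{1..M}. P m) = mat 1"
      by (simp add: P spectral_matrix_sum one[unfolded One_nat_def] spectral_matrix_1 U
          del: sum_of_bool_eq)
    then have "H = H ** (\<Sum>m\<in>{1..M}. P m)" by simp
    also have "\<dots> = (\<Sum>m\<in>{1..M}. H ** P m)"
      by (induction M) (simp_all add: matrix_add_ldistrib)
    also have "\<dots> = (\<Sum>m\<in>{1..M}. \<mu> m *\<^sub>R P m)" by (simp add: \<mu>)
    also have "\<dots> = spectral_matrix U
        (\<lambda>n. \<Sum>m\<in>{1..M}. \<mu> m * of_bool (joint_eigenvalue lam n = \<gamma> m))"
      by (simp add: P spectral_matrix_scaleR spectral_matrix_sum del: sum_mult_of_bool_eq)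
    finally have H: "H = spectral_matrix U
        (\<lambda>n. \<Sum>m\<in>{1..M}. \<mu> m * of_bool (joint_eigenvalue lam n = \<gamma> m))" .
    \<comment> \<open>The diagonal entries of \<open>H\<close> depend on \<open>n\<close> only
      through the joint eigenvalue, so they are values of a function on a finite subset of
      \<open>real^'d\<close>, which can be interpolated.\<close>
    obtain h where "\<And>n. mpoly_value h (joint_eigenvalue lam n)
        = (\<Sum>m\<in>{1..M}. \<mu> m * of_bool (joint_eigenvalue lam n = \<gamma> m))"
      using mpoly_interpolation[of "range (joint_eigenvalue lam)"
        "\<lambda>x. \<Sum>m\<in>{1..M}. \<mu> m * of_bool (x = \<gamma> m)"] by (auto simp del: sum_mult_of_bool_eq)
    then have "H = matrix_eval_mpoly S h"
      by (simp only: H S matrix_eval_mpoly_spectral_matrix[OF U])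
    then show "polynomial_filter S H" by (auto simp: polynomial_filter_def)
  qed
qed

end
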